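(* Let $x_0^0=\frac{t}{3^k}$ with $k,t\in\mathbb{N}$, $t$ and $3$ relatively prime, $k\neq 0$ and $0<t<3^k$. Further, let $m\in\mathbb{R}$. If for every $p,q,r,s\in\mathbb{Z}$ with $r,s\geq 0$ we have $$m\neq \frac{q\,2^{r-s}\,3^k}{p\,3^k-t\,2^r},$$ then the line $y=m(x-x_0^0)$ in the plane does not contain any point of the form $\left(\frac{a}{2^c},\frac{b}{2^d}\right)$ with $a,b,c,d\in\mathbb{Z}$ and $c,d\geq 0$. *)

theory Defs
  imports Complex_Main
begin

end

theory Submission
  imports Defs
begin

text \<open>A dyadic point \<open>(a / 2^c, b / 2^d)\<close> on the line determines its slope, because its abscissa
  differs from \<open>t / 3^k\<close>: a fraction with a nontrivial power of \<open>3\<close> as reduced denominator is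
  not dyadic. Solving the equation of the line for \<open>m\<close> and clearing denominators gives
  the excluded quotient with \<open>p = a\<close>, \<open>q = b\<close>, \<open>r = c\<close>, \<open>s = d\<close>.\<close>

text \<open>Equality would make \<open>3\<close> a divisor of \<open>t * 2 ^ n\<close>, to which it is coprime. In the theorem the
  difference of the two sides is the denominator of the quotient.\<close>

lemma triadic_neq_dyadic:
  fixes t k n :: nat and a :: int
  assumes "coprime t 3" and "k \<noteq> 0"
  shows "a * 3 ^ k \<noteq> int t * 2 ^ n"
proof
  assume eq: "a * 3 ^ k = int t * 2 ^ n"
  have "(3::int) dvd a * 3 ^ k"
    using \<open>k \<noteq> 0\<close> by simp
  then have "(3::int) dvd int t * 2 ^ n"
    by (simp add: eq)
  moreover have "coprime (3::int) (int t * 2 ^ n)"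
  proof -
    have "coprime (int t) (int 3)"
      using \<open>coprime t 3\<close> by (simp only: coprime_int_iff)
    then have "coprime (3::int) (int t)"
      by (simp add: coprime_commute)
    moreover have "coprime (3::int) 2"
      by simp
    ultimately show ?thesis
      by simp
  qed
  ultimately show False
    using coprime_common_divisor[of "3::int" "int t * 2 ^ n" 3] by simp
qed

theorem theorem4p27:
  fixes t k :: nat and x00 m :: real
  assumes x00: "x00 = real t / 3 ^ k"
    and "coprime t 3" and "k \<noteq> 0" and "0 < t" and "t < 3 ^ k"
    and m: "\<forall>p q r s :: int. r \<ge> 0 \<longrightarrow> s \<ge> 0 \<longrightarrow>
      m \<noteq> (of_int q * 2 powi (r - s) * 3 ^ k) / (of_int p * 3 ^ k - real t * 2 powi r)"
  shows "\<forall>a b c d :: int. c \<ge> 0 \<longrightarrow> d \<ge> 0 \<longrightarrow>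
    (of_int a / 2 powi c, of_int b / 2 powi d) \<notin> {(x, y). y = m * (x - x00)}"
proof (intro allI impI notI)
  fix a b c d :: int
  assume c: "c \<ge> 0" and d: "d \<ge> 0"
    and "(of_int a / 2 powi c, of_int b / 2 powi d) \<in> {(x, y). y = m * (x - x00)}"
  then have line: "of_int b / 2 powi d = m * (of_int a / 2 powi c - real t / 3 ^ k)"
    by (simp add: x00)
  define D where "D = of_int a * 3 ^ k - real t * 2 powi c"
  have "D \<noteq> 0"
  proof
    assume "D = 0"
    moreover obtain n where "c = int n"
      using c nonneg_int_cases by blast
    ultimately have "real_of_int (a * 3 ^ k) = real_of_int (int t * 2 ^ n)"
      by (simp add: D_def)
    then have "a * 3 ^ k = int t * 2 ^ n"
      by (simp only: of_int_eq_iff)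
    with triadic_neq_dyadic[OF \<open>coprime t 3\<close> \<open>k \<noteq> 0\<close>] show False
      by blast
  qed
  have "of_int a / 2 powi c - real t / 3 ^ k = D / (2 powi c * 3 ^ k)"
    by (simp add: D_def field_simps)
  with line have "of_int b / 2 powi d = m * D / (2 powi c * 3 ^ k)"
    by simp
  then have "m * D = of_int b * (2 powi c / 2 powi d) * 3 ^ k"
    by (simp add: field_simps)
  also have "2 powi c / 2 powi d = (2::real) powi (c - d)"
    by (simp add: power_int_diff)
  finally have "m = of_int b * 2 powi (c - d) * 3 ^ k / D"
    using \<open>D \<noteq> 0\<close> by (simp add: field_simps)
  with m c d show False
    unfolding D_def by blast
qed

end
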